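(* Suppose that $K^*=\mathscr{P}_d(S)+Y^*$ and that, for every $\mu\in\mathcal{M}$, the polynomial $x\mapsto \mathbb{E}_\mu[h(x,\xi)]$ is SOS-concave. Then the problem $$\text{(R)}\qquad \min_{(x,w)} f(x)\quad \text{s.t.}\quad (Hw)^T[\xi]_d\in \mathscr{P}_d(S)+Y^*,\quad x=\pi(w)\in X,\quad M_t[w]\succeq 0,\quad w_0=1,\ w\in\mathbb{R}^{\mathbb{N}^n_{2t}}$$ is a tight relaxation of the distributionally robust optimization problem $$\text{(DRO)}\qquad \min_{x\in X} f(x)\quad\text{s.t.}\quad \inf_{\mu\in\mathcal{M}}\mathbb{E}_\mu[h(x,\xi)]\ge 0,$$ in the following sense: a point $x$ is an optimizer of (DRO) if and only if there is a $w$ such that $(x,w)$ is an optimizer of (R).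
   Context: Variables: $x=(x_1,\dots,x_n)$ (decision) and $\xi=(\xi_1,\dots,\xi_p)$ (random). For $u\in\{x,\xi\}$ of dimension $l$, $\mathbb{N}^l_e=\{\alpha\in\mathbb{N}^l:|\alpha|\le e\}$, $[u]_e=(u^\alpha)_{\alpha\in\mathbb{N}^l_e}$ is the monomial vector, and $\mathbb{R}[u]_e$ is the space of real polynomials in $u$ of degree at most $e$. For $q=\sum_\alpha q_\alpha u^\alpha\in\mathbb{R}[u]_e$ and a vector $y\in\mathbb{R}^{\mathbb{N}^l_e}$, $\langle q,y\rangle=\sum_\alpha q_\alpha y_\alpha$. Data: $f\in\mathbb{R}[x]$, $h(x,\xi)\in\mathbb{R}[x,\xi]$, $X=\{x\in\mathbb{R}^n: c_1(x)\ge0,\dots,c_m(x)\ge 0\}$ with $c=(c_1,\dots,c_m)$, $c_i\in\mathbb{R}[x]$; $S=\{\xi\in\mathbb{R}^p: g_1(\xi)\ge0,\dots,g_{m_1}(\xi)\ge0\}$ with $g_i\in\mathbb{R}[\xi]$. Let $d$ be the degree of $h$ in $\xi$. The set $Y\subseteq\mathbb{R}^{\mathbb{N}^p_d}$ is given by linear, second-order cone and semidefinite constraints. The moment ambiguity set $\mathcal{M}$ is the set of (nonnegative) Borel measures $\mu$ on $\mathbb{R}^p$ with $\mathrm{supp}(\mu)\subseteq S$ and $\mathbb{E}_\mu([\xi]_d)\in Y$, where $\mathbb{E}_\mu$ denotes integration with respect to $\mu$. Let $t=\max\{\lceil \deg_x(h)/2\rceil,\lceil\deg(f)/2\rceil,\lceil\deg(c)/2\rceil\}$,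 where $\deg_x$ is the degree in $x$ and $\deg(c)=\max_i\deg(c_i)$. Write $h(x,\xi)=\sum_{\beta\in\mathbb{N}^p_d}h_\beta(x)\xi^\beta$; $H$ is the unique real matrix with $(h_\beta(x))_{\beta\in\mathbb{N}^p_d}=H[x]_{2t}$. Thus $(Hw)^T[\xi]_d$ is a polynomial in $\xi$ for each $w\in\mathbb{R}^{\mathbb{N}^n_{2t}}$. Cones: $cone(\cdot)$ is the conic hull (finite nonnegative combinations). $K=cone(\{\mathbb{E}_\mu([\xi]_d):\mu\in\mathcal{M}\})$. For a set $T\subseteq\mathbb{R}^{\mathbb{N}^p_d}$, its dual cone is $T^*=\{q\in\mathbb{R}[\xi]_d:\langle q,y\rangle\ge0\ \forall y\in T\}$. $\mathscr{P}_d(S)=\{q\in\mathbb{R}[\xi]_d: q\ge 0\text{ on }S\}$. For $w\in\mathbb{R}^{\mathbb{N}^n_{2t}}$: $M_t[w]=(w_{\alpha+\beta})_{\alpha,\beta\in\mathbb{N}^n_t}$ is the moment matrix, $w_0$ is the entry indexed by $\alpha=0$, and $\pi(w)=(w_{e_1},\dots,w_{e_n})$. A polynomial $\psi\in\mathbb{R}[x]$ is SOS-convex if $\nabla^2\psi(x)=L(x)L(x)^T$ for some matrix polynomial $L(x)$; it is SOS-concave if $-\psi$ is SOS-convex. *)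

theory Defs
  imports "HOL-Analysis.Analysis" "HOL-Analysis.Finite_Function_Topology"
begin

section \<open>Polynomials and truncated multi-sequences\<close>

text \<open>The variables are indexed by a finite type, so points of the \<open>l\<close>-dimensional
  real space have type \<open>real ^ 'l\<close>. Polynomials carry the convolution product of
  \<open>HOL-Library.Poly_Mapping\<close>. The real vectors indexed by the multi-indices of degree at most
  \<open>e\<close> are the finitely supported functions with support among these multi-indices; hence they
  have the same underlying type as the polynomials of degree at most \<open>e\<close>, a polynomial
  being identified with its coefficient vector.\<close>

type_synonym 'l mindex = "'l \<Rightarrow>\<^sub>0 nat"
type_synonym 'l mpoly = "'l mindex \<Rightarrow>\<^sub>0 real"
type_synonym 'l mvec = "'l mindex \<Rightarrow>\<^sub>0 real"

abbreviation lookup :: "('a \<Rightarrow>\<^sub>0 'b::zero) \<Rightarrow> 'a \<Rightarrow> 'b" where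
  "lookup \<equiv> Poly_Mapping.lookup"

abbreviation keys :: "('a \<Rightarrow>\<^sub>0 'b::zero) \<Rightarrow> 'a set" where
  "keys \<equiv> Poly_Mapping.keys"

definition mdeg :: "'l::finite mindex \<Rightarrow> nat" where
  "mdeg \<alpha> = (\<Sum>i\<in>UNIV. lookup \<alpha> i)"

definition mindices :: "nat \<Rightarrow> 'l::finite mindex set" where
  "mindices e = {\<alpha>. mdeg \<alpha> \<le> e}"

definition truncated :: "nat \<Rightarrow> ('l::finite mindex \<Rightarrow>\<^sub>0 real) set" where
  "truncated e = {v. keys v \<subseteq> mindices e}"

definition pairing :: "'l mpoly \<Rightarrow> 'l mvec \<Rightarrow> real" where
  "pairing q y = (\<Sum>\<alpha>\<in>keys q. lookup q \<alpha> * lookup y \<alpha>)"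

definition monom_at :: "'l::finite mindex \<Rightarrow> real ^ 'l \<Rightarrow> real" where
  "monom_at \<alpha> u = (\<Prod>i\<in>UNIV. (u $ i) ^ lookup \<alpha> i)"

definition peval :: "'l::finite mpoly \<Rightarrow> real ^ 'l \<Rightarrow> real" where
  "peval q u = (\<Sum>\<alpha>\<in>keys q. lookup q \<alpha> * monom_at \<alpha> u)"

text \<open>All degrees of zero objects, and the degree of an empty tuple, are \<open>0\<close>.\<close>

definition pdeg :: "'l::finite mpoly \<Rightarrow> nat" where
  "pdeg q = Max (insert 0 (mdeg ` keys q))"

definition pdeg_list :: "'l::finite mpoly list \<Rightarrow> nat" where
  "pdeg_list qs = Max (insert 0 (pdeg ` set qs))"

definition basic_set :: "'l::finite mpoly list \<Rightarrow> (real ^ 'l) set" where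
  "basic_set qs = {u. \<forall>q\<in>set qs. 0 \<le> peval q u}"

definition partial_deriv :: "'l \<Rightarrow> 'l mpoly \<Rightarrow> 'l mpoly" where
  "partial_deriv i q =
     (\<Sum>\<alpha>\<in>keys q. Poly_Mapping.single (\<alpha> - Poly_Mapping.single i 1)
        (real (lookup \<alpha> i) * lookup q \<alpha>))"

text \<open>The matrix polynomial \<open>L\<close> may have any number \<open>r\<close> of columns.\<close>

definition sos_convex :: "'l::finite mpoly \<Rightarrow> bool" where
  "sos_convex \<psi> \<longleftrightarrow> (\<exists>(r::nat) (L :: 'l \<Rightarrow> nat \<Rightarrow> 'l mpoly).
     \<forall>i j. partial_deriv i (partial_deriv j \<psi>) = (\<Sum>k<r. L i k * L j k))"

definition sos_concave :: "'l::finite mpoly \<Rightarrow> bool" where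
  "sos_concave \<psi> \<longleftrightarrow> sos_convex (- \<psi>)"


section \<open>Polynomials in decision and random variables\<close>

text \<open>A polynomial in \<open>(x, \<xi>)\<close> is a polynomial in \<open>\<xi>\<close> whose coefficients \<open>lookup h \<beta>\<close>
  are polynomials in \<open>x\<close>.\<close>

type_synonym ('n, 'p) mpoly2 = "'p mindex \<Rightarrow>\<^sub>0 'n mpoly"

definition peval2 :: "('n::finite, 'p::finite) mpoly2 \<Rightarrow> real ^ 'n \<Rightarrow> real ^ 'p \<Rightarrow> real" where
  "peval2 h x \<xi> = (\<Sum>\<beta>\<in>keys h. peval (lookup h \<beta>) x * monom_at \<beta> \<xi>)"

definition deg_random :: "('n, 'p::finite) mpoly2 \<Rightarrow> nat" where
  "deg_random h = Max (insert 0 (mdeg ` keys h))"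

definition deg_decision :: "('n::finite, 'p) mpoly2 \<Rightarrow> nat" where
  "deg_decision h = Max (insert 0 ((\<lambda>\<beta>. pdeg (lookup h \<beta>)) ` keys h))"

definition relax_order ::
    "'n::finite mpoly \<Rightarrow> 'n mpoly list \<Rightarrow> ('n, 'p) mpoly2 \<Rightarrow> nat" where
  "relax_order f c h =
     Max {nat \<lceil>real (deg_decision h) / 2\<rceil>, nat \<lceil>real (pdeg f) / 2\<rceil>,
          nat \<lceil>real (pdeg_list c) / 2\<rceil>}"

definition coeff_matrix :: "('n, 'p) mpoly2 \<Rightarrow> 'p mindex \<Rightarrow> 'n mindex \<Rightarrow> real" where
  "coeff_matrix h \<beta> \<alpha> = lookup (lookup h \<beta>) \<alpha>"

text \<open>The polynomial \<open>(H w)\<^sup>T [\<xi>]\<^sub>d\<close> in \<open>\<xi>\<close>, where the columns of \<open>H\<close> are indexed by the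
  multi-indices of degree at most \<open>2 t\<close>.\<close>

definition lifted_poly ::
    "('n::finite, 'p::finite) mpoly2 \<Rightarrow> nat \<Rightarrow> nat \<Rightarrow> 'n mvec \<Rightarrow> 'p mpoly" where
  "lifted_poly h d t w =
     (\<Sum>\<beta>\<in>mindices d. Poly_Mapping.single \<beta>
        (\<Sum>\<alpha>\<in>mindices (2 * t). coeff_matrix h \<beta> \<alpha> * lookup w \<alpha>))"


section \<open>Cones\<close>

definition dual_cone :: "nat \<Rightarrow> 'l::finite mvec set \<Rightarrow> 'l mpoly set" where
  "dual_cone d T = {q \<in> truncated d. \<forall>y\<in>T. 0 \<le> pairing q y}"

definition nonneg_polys :: "nat \<Rightarrow> (real ^ 'l::finite) set \<Rightarrow> 'l mpoly set" where
  "nonneg_polys d S = {q \<in> truncated d. \<forall>u\<in>S. 0 \<le> peval q u}"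

definition psd_on :: "'i set \<Rightarrow> ('i \<Rightarrow> 'i \<Rightarrow> real) \<Rightarrow> bool" where
  "psd_on I A \<longleftrightarrow> (\<forall>i\<in>I. \<forall>j\<in>I. A i j = A j i) \<and>
     (\<forall>v. 0 \<le> (\<Sum>i\<in>I. \<Sum>j\<in>I. v i * A i j * v j))"

definition affine_forms :: "nat \<Rightarrow> ('l::finite mvec \<Rightarrow> real) set" where
  "affine_forms d = {\<phi>. \<exists>b. \<exists>q\<in>truncated d. \<phi> = (\<lambda>y. b + pairing q y)}"

inductive conic_constraint :: "nat \<Rightarrow> 'l::finite mvec set \<Rightarrow> bool" for d where
  linear_ineq: "\<phi> \<in> affine_forms d \<Longrightarrow> conic_constraint d {y. 0 \<le> \<phi> y}"
| linear_eq: "\<phi> \<in> affine_forms d \<Longrightarrow> conic_constraint d {y. \<phi> y = 0}"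
| second_order: "\<lbrakk>\<phi> \<in> affine_forms d; \<And>i. i < k \<Longrightarrow> \<psi> i \<in> affine_forms d\<rbrakk>
    \<Longrightarrow> conic_constraint d {y. sqrt (\<Sum>i<(k::nat). (\<psi> i y)\<^sup>2) \<le> \<phi> y}"
| semidefinite: "\<lbrakk>\<And>i j. \<lbrakk>i < k; j < k\<rbrakk> \<Longrightarrow> A i j \<in> affine_forms d;
      \<And>i j. \<lbrakk>i < k; j < k\<rbrakk> \<Longrightarrow> A i j = A j i\<rbrakk>
    \<Longrightarrow> conic_constraint d {y. psd_on {..<k::nat} (\<lambda>i j. A i j y)}"

definition conic_set :: "nat \<Rightarrow> 'l::finite mvec set \<Rightarrow> bool" where
  "conic_set d Y \<longleftrightarrow>
     (\<exists>\<C>. finite \<C> \<and> (\<forall>C\<in>\<C>. conic_constraint d C) \<and> Y = truncated d \<inter> \<Inter>\<C>)"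


section \<open>Moment ambiguity sets\<close>

definition msupport :: "'a::topological_space measure \<Rightarrow> 'a set" where
  "msupport \<mu> = {u. \<forall>U. open U \<longrightarrow> u \<in> U \<longrightarrow> 0 < emeasure \<mu> U}"

definition moment_vec :: "nat \<Rightarrow> (real ^ 'p::finite) measure \<Rightarrow> 'p mvec" where
  "moment_vec d \<mu> =
     (\<Sum>\<alpha>\<in>mindices d. Poly_Mapping.single \<alpha> (\<integral>\<xi>. monom_at \<alpha> \<xi> \<partial>\<mu>))"

text \<open>The moments up to order \<open>d\<close> are required to exist, since the Bochner integral of a
  non-integrable function is \<open>0\<close> by convention. Taking \<open>\<alpha> = 0\<close>, all measures in the
  ambiguity set are finite, but they need not be normalised.\<close>

definition ambiguity_set ::
    "nat \<Rightarrow> (real ^ 'p::finite) set \<Rightarrow> 'p mvec set \<Rightarrow> (real ^ 'p) measure set" where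
  "ambiguity_set d S Y =
     {\<mu>. sets \<mu> = sets borel \<and> msupport \<mu> \<subseteq> S \<and>
         (\<forall>\<alpha>\<in>mindices d. integrable \<mu> (monom_at \<alpha>)) \<and> moment_vec d \<mu> \<in> Y}"

text \<open>The polynomial \<open>x \<mapsto> \<integral> h(x, \<xi>) d\<mu>(\<xi>)\<close>, integrated coefficientwise in \<open>x\<close>; see
  lemma \<open>peval_expected_poly\<close> below.\<close>

definition expected_poly ::
    "('n, 'p::finite) mpoly2 \<Rightarrow> (real ^ 'p) measure \<Rightarrow> 'n mpoly" where
  "expected_poly h \<mu> = (\<Sum>\<beta>\<in>keys h. (\<integral>\<xi>. monom_at \<beta> \<xi> \<partial>\<mu>) *\<^sub>R lookup h \<beta>)"


section \<open>The two optimization problems\<close>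

text \<open>The infimum is taken in the extended reals, so that it is \<open>\<infinity>\<close> for an empty ambiguity
  set and may be \<open>-\<infinity>\<close>.\<close>

definition dro_feasible ::
    "('n::finite, 'p::finite) mpoly2 \<Rightarrow> (real ^ 'n) set \<Rightarrow> (real ^ 'p) measure set
      \<Rightarrow> real ^ 'n \<Rightarrow> bool" where
  "dro_feasible h X M x \<longleftrightarrow> x \<in> X \<and> 0 \<le> (INF \<mu>\<in>M. ereal (\<integral>\<xi>. peval2 h x \<xi> \<partial>\<mu>))"

definition first_moments :: "'n::finite mvec \<Rightarrow> real ^ 'n" where
  "first_moments w = (\<chi> i. lookup w (Poly_Mapping.single i 1))"

text \<open>The entries of \<open>w\<close> are indexed by the multi-indices of degree at most \<open>2 t\<close>. In the
  degenerate case \<open>t = 0\<close> (where \<open>f\<close>, all \<open>c\<^sub>i\<close> and \<open>h\<close> are constant in \<open>x\<close>) the first order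
  entries are kept as well, because otherwise \<open>first_moments w\<close> would be meaningless.\<close>

definition relax_feasible ::
    "('n::finite, 'p::finite) mpoly2 \<Rightarrow> nat \<Rightarrow> nat \<Rightarrow> (real ^ 'n) set \<Rightarrow> 'p mpoly set
      \<Rightarrow> (real ^ 'n) \<times> 'n mvec \<Rightarrow> bool" where
  "relax_feasible h d t X Q = (\<lambda>(x, w).
     w \<in> truncated (max (2 * t) 1) \<and>
     lifted_poly h d t w \<in> Q \<and>
     x = first_moments w \<and> x \<in> X \<and>
     psd_on (mindices t) (\<lambda>\<alpha> \<beta>. lookup w (\<alpha> + \<beta>)) \<and>
     lookup w 0 = 1)"


section \<open>Consistency of the encodings\<close>

lemma finite_mindices [simp]: "finite (mindices e :: 'l::finite mindex set)"
proof -
  have "lookup ` (mindices e :: 'l mindex set) \<subseteq> PiE UNIV (\<lambda>_. {..e})"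
  proof (clarsimp simp: mindices_def mdeg_def PiE_def Pi_def)
    fix \<alpha> :: "'l mindex" and i
    assume "(\<Sum>i\<in>UNIV. lookup \<alpha> i) \<le> e"
    moreover have "lookup \<alpha> i \<le> (\<Sum>i\<in>UNIV. lookup \<alpha> i)"
      by (rule member_le_sum) auto
    ultimately show "lookup \<alpha> i \<le> e" by linarith
  qed
  then have "finite (lookup ` (mindices e :: 'l mindex set))"
    by (rule finite_subset) (auto intro: finite_PiE)
  then show ?thesis
    by (rule finite_imageD) (auto simp: inj_on_def lookup_inject)
qed

lemma peval_superset:
  fixes q :: "'l::finite mpoly"
  assumes "finite A" "keys q \<subseteq> A"
  shows "peval q u = (\<Sum>\<alpha>\<in>A. lookup q \<alpha> * monom_at \<alpha> u)"
  unfolding peval_def using assms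
  by (intro sum.mono_neutral_left) (auto simp: in_keys_iff)

lemma mdeg_le_deg_random: "\<beta> \<in> keys h \<Longrightarrow> mdeg \<beta> \<le> deg_random h"
  unfolding deg_random_def by (intro Max_ge) auto

lemma coeff_in_truncated:
  fixes h :: "('n::finite, 'p::finite) mpoly2"
  assumes "deg_decision h \<le> e"
  shows "lookup h \<beta> \<in> truncated e"
proof -
  have "mdeg \<alpha> \<le> e" if "\<alpha> \<in> keys (lookup h \<beta>)" for \<alpha>
  proof -
    from that have "\<beta> \<in> keys h" by (auto simp: in_keys_iff)
    then have "pdeg (lookup h \<beta>) \<le> deg_decision h"
      unfolding deg_decision_def by (intro Max_ge) auto
    moreover from that have "mdeg \<alpha> \<le> pdeg (lookup h \<beta>)"
      unfolding pdeg_def by (intro Max_ge) auto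
    ultimately show ?thesis using assms by linarith
  qed
  then show ?thesis by (auto simp: truncated_def mindices_def)
qed

lemma deg_decision_le_relax_order: "deg_decision h \<le> 2 * relax_order f c h"
proof -
  have "nat \<lceil>real (deg_decision h) / 2\<rceil> \<le> relax_order f c h"
    unfolding relax_order_def by (intro Max_ge) auto
  then show ?thesis by linarith
qed

text \<open>The defining property of the matrix \<open>H\<close>.\<close>

lemma peval_coeff_matrix:
  fixes h :: "('n::finite, 'p::finite) mpoly2"
  shows "peval (lookup h \<beta>) x =
    (\<Sum>\<alpha>\<in>mindices (2 * relax_order f c h). coeff_matrix h \<beta> \<alpha> * monom_at \<alpha> x)"
proof -
  have "lookup h \<beta> \<in> truncated (2 * relax_order f c h)"
    by (intro coeff_in_truncated deg_decision_le_relax_order)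
  then show ?thesis
    unfolding coeff_matrix_def by (intro peval_superset) (auto simp: truncated_def)
qed

lemma peval_expected_poly:
  fixes h :: "('n::finite, 'p::finite) mpoly2"
  assumes "\<mu> \<in> ambiguity_set (deg_random h) S Y"
  shows "peval (expected_poly h \<mu>) x = (\<integral>\<xi>. peval2 h x \<xi> \<partial>\<mu>)"
proof -
  define A where "A = (mindices (deg_decision h) :: 'n mindex set)"
  define m where "m \<beta> = (\<integral>\<xi>. monom_at \<beta> \<xi> \<partial>\<mu>)" for \<beta>
  have A: "keys (lookup h \<beta>) \<subseteq> A" for \<beta>
    using coeff_in_truncated[of h "deg_decision h" \<beta>] by (auto simp: truncated_def A_def)
  have lk: "lookup (r *\<^sub>R q) \<alpha> = r * lookup q \<alpha>" for r and q :: "'n mpoly" and \<alpha>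
  proof -
    have "finite {i. r *\<^sub>R lookup q i \<noteq> 0}"
      by (rule finite_subset[OF _ finite_keys[of q]]) (auto simp: in_keys_iff)
    then show ?thesis by (simp add: scaleR_poly_mapping_def)
  qed
  have l: "lookup (expected_poly h \<mu>) \<alpha> = (\<Sum>\<beta>\<in>keys h. m \<beta> * lookup (lookup h \<beta>) \<alpha>)" for \<alpha>
    by (simp add: expected_poly_def lookup_sum lk m_def)
  have "keys (expected_poly h \<mu>) \<subseteq> A"
  proof
    fix \<alpha> assume "\<alpha> \<in> keys (expected_poly h \<mu>)"
    then have "(\<Sum>\<beta>\<in>keys h. m \<beta> * lookup (lookup h \<beta>) \<alpha>) \<noteq> 0"
      by (simp add: in_keys_iff l)
    then obtain \<beta> where "m \<beta> * lookup (lookup h \<beta>) \<alpha> \<noteq> 0"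
      by (meson sum.neutral)
    then show "\<alpha> \<in> A" using A[of \<beta>] by (auto simp: in_keys_iff)
  qed
  then have "peval (expected_poly h \<mu>) x =
      (\<Sum>\<alpha>\<in>A. \<Sum>\<beta>\<in>keys h. m \<beta> * lookup (lookup h \<beta>) \<alpha> * monom_at \<alpha> x)"
    by (subst peval_superset[of A]) (auto simp: A_def l sum_distrib_right)
  also have "\<dots> = (\<Sum>\<beta>\<in>keys h. peval (lookup h \<beta>) x * m \<beta>)"
    by (subst sum.swap) (simp add: peval_superset[OF _ A] A_def sum_distrib_left mult_ac)
  also have "\<dots> = (\<integral>\<xi>. peval2 h x \<xi> \<partial>\<mu>)"
  proof -
    have "integrable \<mu> (\<lambda>\<xi>. monom_at \<beta> \<xi>)" if "\<beta> \<in> keys h" for \<beta>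
      using assms mdeg_le_deg_random[OF that] by (auto simp: ambiguity_set_def mindices_def)
    then show ?thesis
      unfolding peval2_def m_def by (subst Bochner_Integration.integral_sum) auto
  qed
  finally show ?thesis .
qed

end

theory Submission
  imports Defs
begin

text \<open>The relaxation lifts the monomial vector of \<open>x\<close> to a pseudo-moment vector \<open>w\<close>, and
  pairing with \<open>w\<close> replaces evaluation at \<open>x\<close>. Both problems have the same objective in
  \<open>x\<close>, so it suffices that the feasible set of the distributionally robust problem is the
  projection of the feasible set of the relaxation.

  By the hypothesis on the dual cone, the conic constraint on \<open>w\<close> says that the lifted polynomial
  pairs nonnegatively with all moment vectors of the ambiguity set, and exchanging the two
  linear functionals turns this into
  \<open>0 \<le> pairing (expected_poly h \<mu>) w\<close> for all \<open>\<mu>\<close> (\<open>lifted_poly_in_dual_cone_iff\<close>). The robust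
  constraint reads \<open>0 \<le> peval (expected_poly h \<mu>) x\<close> for all \<open>\<mu>\<close> (\<open>dro_feasible_iff\<close>).
  If \<open>w\<close> is the vector of monomials at \<open>x\<close>, the two inequalities coincide, so every robustly
  feasible \<open>x\<close> lifts. For the projection one needs that the pairing with \<open>w\<close> never exceeds the
  value at \<open>x = first_moments w\<close>. This is Jensen's inequality, which for SOS-concave polynomials
  holds although \<open>w\<close> need not come from a probability measure (\<open>sos_convex_jensen\<close>).

  To prove it for an SOS-convex \<open>\<psi>\<close>, put \<open>y = first_moments w\<close> and let \<open>\<phi> s\<close> be the
  pairing of the polynomial \<open>\<psi> (y + s (x - y))\<close> in \<open>x\<close> with \<open>w\<close>. Then \<open>\<phi>\<close> is a function of
  one real variable with \<open>\<phi> 0 = \<psi> y\<close>, and \<open>\<phi> 1\<close> is the pairing of \<open>\<psi>\<close> with \<open>w\<close>. The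
  derivative \<open>\<phi>' 0\<close> vanishes because \<open>w\<close> annihilates \<open>x - y\<close>. The second derivative at \<open>s\<close>
  is the pairing of \<open>w\<close> with the quadratic form of the Hessian along \<open>x - y\<close>. That form is a
  sum of squares, so the moment matrix makes \<open>\<phi>''\<close> nonnegative, and \<open>\<phi> 0 \<le> \<phi> 1\<close> follows.
  The moment matrix only controls squares of polynomials of degree at most \<open>t\<close>. That the factors
  of the Hessian are small enough follows because leading terms of a sum of squares cannot cancel
  (\<open>sum_squares_mdeg\<close>).\<close>

section \<open>The algebra of multivariate polynomials\<close>

abbreviation pconst :: "real \<Rightarrow> 'l mpoly" where
  "pconst r \<equiv> Poly_Mapping.single 0 r"

definition pvar :: "'l \<Rightarrow> 'l mpoly" where
  "pvar i = Poly_Mapping.single (Poly_Mapping.single i 1) 1"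

lemma mdeg_add [simp]: "mdeg (\<alpha> + \<beta>) = mdeg \<alpha> + mdeg \<beta>"
  by (simp add: mdeg_def lookup_add sum.distrib)

lemma mdeg_zero [simp]: "mdeg 0 = 0"
  by (simp add: mdeg_def)

lemma mdeg_single [simp]: "mdeg (Poly_Mapping.single i n) = n"
  by (simp add: mdeg_def lookup_single when_def)

lemma mindex_split:
  assumes "lookup \<alpha> i \<noteq> (0::nat)"
  shows "\<alpha> = Poly_Mapping.single i 1 + (\<alpha> - Poly_Mapping.single i 1)"
  using assms by (intro poly_mapping_eqI) (auto simp: lookup_add lookup_minus lookup_single when_def)

lemma mpoly_sum_monomials:
  fixes q :: "'l mpoly"
  assumes "finite A" "keys q \<subseteq> A"
  shows "(\<Sum>\<alpha>\<in>A. Poly_Mapping.single \<alpha> (lookup q \<alpha>)) = q"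
proof (rule poly_mapping_eqI)
  fix \<beta>
  have "(\<Sum>\<alpha>\<in>A. if \<alpha> = \<beta> then lookup q \<alpha> else 0) = (if \<beta> \<in> A then lookup q \<beta> else 0)"
    using assms(1) by (rule sum.delta)
  then show "lookup (\<Sum>\<alpha>\<in>A. Poly_Mapping.single \<alpha> (lookup q \<alpha>)) \<beta> = lookup q \<beta>"
    using assms(2) by (auto simp: lookup_sum lookup_single when_def in_keys_iff)
qed

text \<open>Substitution and differentiation are determined by their effect on constants and sums
  and on multiplication by one variable; with this rule their laws and the derivative of a
  substituted polynomial reduce to these cases.\<close>

lemma mpoly_induct [case_names const add var]:
  fixes q :: "'l::finite mpoly"
  assumes const: "\<And>r. P (pconst r)"
    and add: "\<And>p q. P p \<Longrightarrow> P q \<Longrightarrow> P (p + q)"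
    and var: "\<And>i q. P q \<Longrightarrow> P (pvar i * q)"
  shows "P q"
proof -
  have mono: "P (Poly_Mapping.single \<alpha> r)" for \<alpha> :: "'l mindex" and r
  proof (induction "mdeg \<alpha>" arbitrary: \<alpha>)
    case 0
    then have "\<alpha> = 0" by (intro poly_mapping_eqI) (auto simp: mdeg_def)
    then show ?case using const by simp
  next
    case (Suc n)
    then obtain i where "lookup \<alpha> i \<noteq> 0"
      by (metis mdeg_def nat.distinct(1) sum.neutral)
    note \<alpha> = mindex_split[OF this]
    have "n = mdeg (\<alpha> - Poly_Mapping.single i 1)"
      using Suc.hyps(2) by (subst (asm) \<alpha>) simp
    then have "P (pvar i * Poly_Mapping.single (\<alpha> - Poly_Mapping.single i 1) r)"
      by (intro var Suc.hyps(1))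
    then show ?case using \<alpha> by (simp add: pvar_def mult_single)
  qed
  have "P (\<Sum>\<alpha>\<in>A. Poly_Mapping.single \<alpha> (lookup q \<alpha>))" if "finite A" for A
    using that
  proof induction
    case empty
    show ?case using const[of 0] by simp
  next
    case (insert \<alpha> A)
    then show ?case by (simp add: add mono)
  qed
  from this[of "keys q"] show ?thesis by (simp add: mpoly_sum_monomials)
qed

lemma mult_eq_sum_monomials:
  fixes p q :: "'l mpoly"
  shows "p * q = (\<Sum>\<alpha>\<in>keys p. \<Sum>\<beta>\<in>keys q.
    Poly_Mapping.single (\<alpha> + \<beta>) (lookup p \<alpha> * lookup q \<beta>))"
proof -
  have "p * q = (\<Sum>\<alpha>\<in>keys p. Poly_Mapping.single \<alpha> (lookup p \<alpha>)) *
      (\<Sum>\<beta>\<in>keys q. Poly_Mapping.single \<beta> (lookup q \<beta>))"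
    by (simp add: mpoly_sum_monomials)
  then show ?thesis by (simp add: sum_product mult_single)
qed

lemma lookup_const_mult:
  fixes q :: "'l mpoly"
  shows "lookup (pconst r * q) \<gamma> = r * lookup q \<gamma>"
  by (simp add: lookup_mult lookup_single when_mult)

lemma lookup_var_mult:
  fixes q :: "'l mpoly"
  shows "lookup (pvar j * q) \<gamma> =
    (if lookup \<gamma> j = 0 then 0 else lookup q (\<gamma> - Poly_Mapping.single j 1))"
proof -
  let ?e = "Poly_Mapping.single j (1::nat)"
  have l: "lookup (pvar j * q) \<gamma> = (\<Sum>\<beta>. lookup q \<beta> when \<gamma> = ?e + \<beta>)"
    by (simp add: pvar_def lookup_mult lookup_single when_mult)
  show ?thesis
  proof (cases "lookup \<gamma> j = 0")
    case True
    then have "\<gamma> \<noteq> ?e + \<beta>" for \<beta> by (auto simp: lookup_add)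
    then show ?thesis using True unfolding l by simp
  next
    case False
    note \<gamma> = mindex_split[OF False]
    have "\<gamma> = ?e + \<beta> \<longleftrightarrow> \<gamma> - ?e = \<beta>" for \<beta>
      by (metis \<gamma> add_diff_cancel_left')
    then show ?thesis using False unfolding l by simp
  qed
qed

lemma truncated_mono: "q \<in> truncated a \<Longrightarrow> a \<le> b \<Longrightarrow> q \<in> truncated b"
  by (fastforce simp: truncated_def mindices_def)

lemma truncated_single: "mdeg \<alpha> \<le> e \<Longrightarrow> Poly_Mapping.single \<alpha> r \<in> truncated e"
  by (simp add: truncated_def mindices_def)

lemma truncated_zero [simp]: "0 \<in> truncated e"
  by (simp add: truncated_def)

lemma truncated_add: "p \<in> truncated e \<Longrightarrow> q \<in> truncated e \<Longrightarrow> p + q \<in> truncated e"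
  using Poly_Mapping.keys_add[of p q] by (auto simp: truncated_def)

lemma truncated_uminus: "p \<in> truncated e \<Longrightarrow> - p \<in> truncated e"
  for p :: "'l::finite mpoly"
  by (auto simp: truncated_def in_keys_iff)

lemma truncated_sum: "(\<And>i. i \<in> I \<Longrightarrow> p i \<in> truncated e) \<Longrightarrow> sum p I \<in> truncated e"
  by (induction I rule: infinite_finite_induct) (auto intro: truncated_add)

lemma truncated_mult:
  fixes p q :: "'l::finite mpoly"
  assumes "p \<in> truncated a" "q \<in> truncated b"
  shows "p * q \<in> truncated (a + b)"
proof -
  have "mdeg (\<alpha> + \<beta>) \<le> a + b" if "\<alpha> \<in> keys p" "\<beta> \<in> keys q" for \<alpha> \<beta>
  proof -
    have "mdeg \<alpha> \<le> a" "mdeg \<beta> \<le> b"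
      using that assms by (auto simp: truncated_def mindices_def)
    then show ?thesis by simp
  qed
  then show ?thesis
    unfolding mult_eq_sum_monomials by (intro truncated_sum truncated_single) auto
qed

lemma truncated_power:
  fixes p :: "'l::finite mpoly"
  assumes "p \<in> truncated a"
  shows "p ^ n \<in> truncated (n * a)"
proof (induction n)
  case 0
  show ?case using truncated_single[of 0 0 1] by simp
next
  case (Suc n)
  then show ?case using truncated_mult[OF assms Suc] by simp
qed

lemma truncated_prod:
  fixes p :: "'i \<Rightarrow> 'l::finite mpoly"
  assumes "finite I" "\<And>i. i \<in> I \<Longrightarrow> p i \<in> truncated (a i)"
  shows "prod p I \<in> truncated (sum a I)"
  using assms
proof (induction I)
  case empty
  show ?case using truncated_single[of 0 0 1] by simp
next
  case (insert i I)
  then show ?case by (simp add: truncated_mult)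
qed

section \<open>Substitution and partial derivatives\<close>

definition psubst :: "('l::finite \<Rightarrow> 'm mpoly) \<Rightarrow> 'l mpoly \<Rightarrow> 'm mpoly" where
  "psubst P q = (\<Sum>\<alpha>\<in>keys q. pconst (lookup q \<alpha>) * (\<Prod>i\<in>UNIV. P i ^ lookup \<alpha> i))"

lemma psubst_superset:
  assumes "finite A" "keys q \<subseteq> A"
  shows "psubst P q = (\<Sum>\<alpha>\<in>A. pconst (lookup q \<alpha>) * (\<Prod>i\<in>UNIV. P i ^ lookup \<alpha> i))"
  unfolding psubst_def using assms
  by (intro sum.mono_neutral_left) (auto simp: in_keys_iff)

lemma psubst_const [simp]: "psubst P (pconst r) = pconst r"
  by (subst psubst_superset[of "{0}"]) auto

lemma psubst_zero [simp]: "psubst P 0 = 0"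
  by (simp add: psubst_def)

lemma psubst_add: "psubst P (p + q) = psubst P p + psubst P q"
proof -
  let ?A = "keys p \<union> keys q"
  have "keys (p + q) \<subseteq> ?A" by (rule Poly_Mapping.keys_add)
  then show ?thesis
    by (simp add: psubst_superset[of ?A] lookup_add single_add distrib_right sum.distrib)
qed

lemma psubst_sum: "psubst P (sum p I) = (\<Sum>i\<in>I. psubst P (p i))"
  by (induction I rule: infinite_finite_induct) (auto simp: psubst_add)

text \<open>Multiplication by a variable only shifts the exponents by one unit, so the sums
  defining the two sides correspond term by term; multiplicativity of the substitution then
  follows by induction.\<close>

lemma psubst_var_mult: "psubst P (pvar j * q) = P j * psubst P q"
proof -
  let ?e = "Poly_Mapping.single j (1::nat)"
  have "keys (pvar j * q) \<subseteq> (+) ?e ` keys q"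
    using keys_mult[of "pvar j" q] by (auto simp: pvar_def)
  then have "psubst P (pvar j * q) = (\<Sum>\<alpha>\<in>(+) ?e ` keys q.
      pconst (lookup (pvar j * q) \<alpha>) * (\<Prod>i\<in>UNIV. P i ^ lookup \<alpha> i))"
    by (intro psubst_superset) auto
  also have "\<dots> = (\<Sum>\<alpha>\<in>keys q.
      pconst (lookup (pvar j * q) (?e + \<alpha>)) * (\<Prod>i\<in>UNIV. P i ^ lookup (?e + \<alpha>) i))"
    by (subst sum.reindex) (auto simp: inj_on_def)
  also have "\<dots> = (\<Sum>\<alpha>\<in>keys q. P j *
      (pconst (lookup q \<alpha>) * (\<Prod>i\<in>UNIV. P i ^ lookup \<alpha> i)))"
  proof (intro sum.cong refl)
    fix \<alpha>
    have "(\<Prod>i\<in>UNIV. P i ^ lookup (?e + \<alpha>) i) =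
        (\<Prod>i\<in>UNIV. (if i = j then P i else 1) * P i ^ lookup \<alpha> i)"
      by (intro prod.cong) (auto simp: lookup_add lookup_single when_def)
    also have "\<dots> = P j * (\<Prod>i\<in>UNIV. P i ^ lookup \<alpha> i)"
      by (subst prod.distrib) (simp add: prod.delta)
    finally show "pconst (lookup (pvar j * q) (?e + \<alpha>)) * (\<Prod>i\<in>UNIV. P i ^ lookup (?e + \<alpha>) i) =
        P j * (pconst (lookup q \<alpha>) * (\<Prod>i\<in>UNIV. P i ^ lookup \<alpha> i))"
      by (simp add: lookup_var_mult lookup_add mult.left_commute)
  qed
  finally show ?thesis by (simp add: psubst_def sum_distrib_left)
qed

lemma psubst_const_mult: "psubst P (pconst r * q) = pconst r * psubst P q"
proof -
  have "keys (pconst r * q) \<subseteq> keys q"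
    by (auto simp: in_keys_iff lookup_const_mult)
  then have "psubst P (pconst r * q) = (\<Sum>\<alpha>\<in>keys q.
      pconst r * (pconst (lookup q \<alpha>) * (\<Prod>i\<in>UNIV. P i ^ lookup \<alpha> i)))"
    by (subst psubst_superset[of "keys q"])
      (auto simp: lookup_const_mult mult_single mult.assoc[symmetric])
  then show ?thesis by (simp add: psubst_def sum_distrib_left)
qed

lemma psubst_mult: "psubst P (p * q) = psubst P p * psubst P q"
  by (induction p rule: mpoly_induct)
    (simp_all add: psubst_const_mult psubst_add psubst_var_mult distrib_right mult.assoc)

lemma psubst_var: "psubst pvar q = q"
  by (induction q rule: mpoly_induct) (simp_all add: psubst_add psubst_var_mult)

lemma psubst_point: "psubst (\<lambda>i. pconst (y $ i)) q = pconst (peval q y)"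
proof -
  have pow: "pconst r ^ n = pconst (r ^ n)" for r n
    by (induction n) (simp_all add: mult_single)
  have prd: "(\<Prod>i\<in>I. pconst (r i)) = pconst (prod r I)" for r I
    by (induction I rule: infinite_finite_induct) (simp_all add: mult_single)
  have sm: "(\<Sum>i\<in>I. pconst (r i)) = pconst (sum r I)" for r I
    by (induction I rule: infinite_finite_induct) (simp_all add: single_add)
  show ?thesis
    by (simp add: psubst_def peval_def monom_at_def pow prd sm mult_single)
qed

text \<open>An affine substitution turns a monomial of degree \<open>e\<close> into a product of \<open>e\<close> affine
  factors and hence preserves the degree bounds under which the moment matrix can be used.\<close>

lemma psubst_truncated:
  assumes "\<And>i. P i \<in> truncated 1" "q \<in> truncated e"
  shows "psubst P q \<in> truncated e"
  unfolding psubst_def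
proof (rule truncated_sum)
  fix \<alpha> assume "\<alpha> \<in> keys q"
  then have e: "mdeg \<alpha> \<le> e" using assms(2) by (auto simp: truncated_def mindices_def)
  have "(\<Prod>i\<in>UNIV. P i ^ lookup \<alpha> i) \<in> truncated (\<Sum>i\<in>UNIV. lookup \<alpha> i)"
    by (rule truncated_prod) (use truncated_power[OF assms(1)] in auto)
  then have "(\<Prod>i\<in>UNIV. P i ^ lookup \<alpha> i) \<in> truncated e"
    using e by (simp add: mdeg_def truncated_mono)
  from truncated_mult[OF truncated_single[of 0 0] this]
  show "pconst (lookup q \<alpha>) * (\<Prod>i\<in>UNIV. P i ^ lookup \<alpha> i) \<in> truncated e" by simp
qed

lemma lookup_partial_deriv:
  "lookup (partial_deriv i q) \<gamma> =
    real (lookup \<gamma> i + 1) * lookup q (\<gamma> + Poly_Mapping.single i 1)"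
proof -
  let ?e = "Poly_Mapping.single i (1::nat)"
  have "lookup (partial_deriv i q) \<gamma> =
      (\<Sum>\<alpha>\<in>keys q. if \<alpha> - ?e = \<gamma> then real (lookup \<alpha> i) * lookup q \<alpha> else 0)"
    by (simp add: partial_deriv_def lookup_sum lookup_single when_def)
  \<comment> \<open>Exponents are truncated at \<open>0\<close> in \<open>\<alpha> - ?e\<close>, but in that case the factor
    \<open>lookup \<alpha> i\<close> vanishes.\<close>
  also have "\<dots> = (\<Sum>\<alpha>\<in>keys q. if \<alpha> = \<gamma> + ?e then real (lookup \<alpha> i) * lookup q \<alpha> else 0)"
  proof (intro sum.cong refl)
    fix \<alpha>
    show "(if \<alpha> - ?e = \<gamma> then real (lookup \<alpha> i) * lookup q \<alpha> else 0) =
        (if \<alpha> = \<gamma> + ?e then real (lookup \<alpha> i) * lookup q \<alpha> else 0)"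
    proof (cases "lookup \<alpha> i = 0")
      case True
      then show ?thesis by simp
    next
      case False
      then have "\<alpha> - ?e = \<gamma> \<longleftrightarrow> \<alpha> = \<gamma> + ?e"
        by (metis add_diff_cancel_right' add.commute mindex_split)
      then show ?thesis by simp
    qed
  qed
  also have "\<dots> = real (lookup \<gamma> i + 1) * lookup q (\<gamma> + ?e)"
    by (auto simp: sum.delta lookup_add in_keys_iff)
  finally show ?thesis .
qed

lemma partial_deriv_add: "partial_deriv i (p + q) = partial_deriv i p + partial_deriv i q"
  by (intro poly_mapping_eqI) (simp add: lookup_partial_deriv lookup_add algebra_simps)

lemma partial_deriv_const [simp]: "partial_deriv (i :: 'l::finite) (pconst r) = 0"
proof (rule poly_mapping_eqI)
  fix \<gamma> :: "'l mindex"
  have "lookup (\<gamma> + Poly_Mapping.single i 1) i \<noteq> 0"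
    by (simp add: lookup_add)
  then have "\<gamma> + Poly_Mapping.single i 1 \<noteq> 0"
    by auto
  then show "lookup (partial_deriv i (pconst r)) \<gamma> = lookup 0 \<gamma>"
    by (simp add: lookup_partial_deriv lookup_single_not_eq)
qed

lemma partial_deriv_var_mult:
  "partial_deriv i (pvar j * q) = (if i = j then q else 0) + pvar j * partial_deriv i q"
proof (rule poly_mapping_eqI)
  fix \<gamma>
  let ?ei = "Poly_Mapping.single i (1::nat)" and ?ej = "Poly_Mapping.single j (1::nat)"
  show "lookup (partial_deriv i (pvar j * q)) \<gamma> =
      lookup ((if i = j then q else 0) + pvar j * partial_deriv i q) \<gamma>"
  proof (cases "lookup \<gamma> j = 0")
    case True
    then show ?thesis
      by (auto simp: lookup_partial_deriv lookup_var_mult lookup_add lookup_single when_def)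
  next
    case False
    then have swap: "\<gamma> - ?ej + ?ei = \<gamma> + ?ei - ?ej"
      by (intro poly_mapping_eqI) (auto simp: lookup_add lookup_minus lookup_single when_def)
    show ?thesis
    proof (cases "i = j")
      case True
      have "real (lookup (\<gamma> - ?ej) j + 1) = real (lookup \<gamma> j)"
        using False by (simp add: lookup_minus)
      then show ?thesis using False True swap
        by (simp add: lookup_partial_deriv lookup_var_mult lookup_add distrib_right)
    next
      case neq: False
      have "lookup (\<gamma> - ?ej) i = lookup \<gamma> i"
        using neq by (simp add: lookup_minus lookup_single_not_eq)
      then show ?thesis using False neq swap
        by (simp add: lookup_partial_deriv lookup_var_mult lookup_add)
    qed
  qed
qed

section \<open>Truncated moment functionals\<close>

lemma pairing_superset:
  assumes "finite A" "keys q \<subseteq> A"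
  shows "pairing q w = (\<Sum>\<alpha>\<in>A. lookup q \<alpha> * lookup w \<alpha>)"
  unfolding pairing_def using assms
  by (intro sum.mono_neutral_left) (auto simp: in_keys_iff)

lemma pairing_zero [simp]: "pairing 0 w = 0"
  by (simp add: pairing_def)

lemma pairing_single: "pairing (Poly_Mapping.single \<alpha> r) w = r * lookup w \<alpha>"
  by (subst pairing_superset[of "{\<alpha>}"]) auto

lemma pairing_add: "pairing (p + q) w = pairing p w + pairing q w"
proof -
  let ?A = "keys p \<union> keys q"
  have "keys (p + q) \<subseteq> ?A" by (rule Poly_Mapping.keys_add)
  then show ?thesis
    by (simp add: pairing_superset[of ?A] lookup_add distrib_right sum.distrib)
qed

lemma pairing_sum: "pairing (sum p I) w = (\<Sum>i\<in>I. pairing (p i) w)"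
  by (induction I rule: infinite_finite_induct) (auto simp: pairing_add)

lemma pairing_const_mult: "pairing (pconst r * q) w = r * pairing q w"
proof -
  have "keys (pconst r * q) \<subseteq> keys q"
    by (auto simp: in_keys_iff lookup_const_mult)
  then show ?thesis
    by (simp add: pairing_superset[of "keys q"] lookup_const_mult sum_distrib_left mult.assoc)
qed

lemma pairing_uminus: "pairing (- q) w = - pairing q w"
  using pairing_add[of q "- q" w] by simp

text \<open>The pairing of \<open>p * p\<close> is the quadratic form of the moment matrix at the coefficient
  vector of \<open>p\<close>.\<close>

lemma pairing_square_nonneg:
  assumes "p \<in> truncated t"
    and psd: "psd_on (mindices t) (\<lambda>\<alpha> \<beta>. lookup w (\<alpha> + \<beta>))"
  shows "0 \<le> pairing (p * p) w"
proof -
  have k: "keys p \<subseteq> mindices t" using assms(1) by (simp add: truncated_def)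
  have "pairing (p * p) w =
      (\<Sum>\<alpha>\<in>keys p. \<Sum>\<beta>\<in>keys p. lookup p \<alpha> * lookup w (\<alpha> + \<beta>) * lookup p \<beta>)"
    by (simp add: mult_eq_sum_monomials pairing_sum pairing_single mult_ac)
  also have "\<dots> =
      (\<Sum>\<alpha>\<in>mindices t. \<Sum>\<beta>\<in>mindices t. lookup p \<alpha> * lookup w (\<alpha> + \<beta>) * lookup p \<beta>)"
    using k by (intro sum.mono_neutral_cong_left sum.mono_neutral_left)
      (auto simp: in_keys_iff intro!: sum.neutral)
  also have "\<dots> \<ge> 0" using psd by (simp add: psd_on_def)
  finally show ?thesis .
qed

section \<open>Degrees in sums of squares\<close>

text \<open>Strict convexity of the Euclidean norm: a point of maximal norm is the midpoint of two
  points of the same set only if both are equal to it. The parallelogram law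
  makes this explicit. It singles out an exponent whose double arises in only one way in a
  product, without the choice of a monomial order.\<close>

lemma max_norm_midpoint:
  fixes \<alpha> \<beta> \<gamma> :: "'l::finite mindex"
  defines "nrm \<equiv> (\<lambda>\<alpha>::'l mindex. \<Sum>i\<in>UNIV. (real (lookup \<alpha> i))\<^sup>2)"
  assumes "\<beta> + \<gamma> = \<alpha> + \<alpha>" "nrm \<beta> \<le> nrm \<alpha>" "nrm \<gamma> \<le> nrm \<alpha>"
  shows "\<beta> = \<alpha>"
proof -
  define D where "D i = real (lookup \<beta> i) - real (lookup \<alpha> i)" for i
  have "(real (lookup \<beta> i))\<^sup>2 + (real (lookup \<gamma> i))\<^sup>2
      = 2 * (real (lookup \<alpha> i))\<^sup>2 + 2 * (D i)\<^sup>2" for i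
  proof -
    have "lookup (\<beta> + \<gamma>) i = lookup (\<alpha> + \<alpha>) i" using assms(2) by simp
    then have g: "real (lookup \<gamma> i) = 2 * real (lookup \<alpha> i) - real (lookup \<beta> i)"
      unfolding lookup_add by linarith
    show ?thesis unfolding g D_def by (simp add: power2_eq_square algebra_simps)
  qed
  then have "nrm \<beta> + nrm \<gamma> = 2 * nrm \<alpha> + 2 * (\<Sum>i\<in>UNIV. (D i)\<^sup>2)"
    by (simp add: nrm_def sum.distrib[symmetric] sum_distrib_left)
  then have "(\<Sum>i\<in>UNIV. (D i)\<^sup>2) \<le> 0" using assms(3,4) by linarith
  then have "(\<Sum>i\<in>UNIV. (D i)\<^sup>2) = 0" by (intro antisym sum_nonneg) auto
  then have "D i = 0" for i by (simp add: sum_nonneg_eq_0_iff)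
  then show ?thesis by (intro poly_mapping_eqI) (simp add: D_def)
qed

text \<open>Among the exponents of the \<open>p k\<close> of maximal degree let \<open>\<tau>\<close> have maximal norm. Then
  \<open>\<tau> + \<tau>\<close> arises only as \<open>\<tau>\<close> plus \<open>\<tau>\<close>, so its coefficient in the sum of squares is a sum of
  squares of reals which are not all zero.\<close>

lemma sum_squares_mdeg:
  fixes p :: "'k \<Rightarrow> 'l::finite mpoly"
  assumes "finite I" "k \<in> I" "\<alpha> \<in> keys (p k)"
  obtains \<beta> where "\<beta> \<in> keys (\<Sum>k\<in>I. p k * p k)" "2 * mdeg \<alpha> \<le> mdeg \<beta>"
proof -
  define nrm where "nrm = (\<lambda>\<alpha>::'l mindex. \<Sum>i\<in>UNIV. (real (lookup \<alpha> i))\<^sup>2)"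
  define A where "A = (\<Union>k\<in>I. keys (p k))"
  have A: "finite A" "\<alpha> \<in> A" using assms by (auto simp: A_def)
  define D where "D = Max (mdeg ` A)"
  have D: "mdeg \<beta> \<le> D" if "\<beta> \<in> A" for \<beta> using that A by (simp add: D_def)
  have "D \<in> mdeg ` A" using A unfolding D_def by (intro Max_in) auto
  define T where "T = {\<beta> \<in> A. mdeg \<beta> = D}"
  have T: "finite T" "T \<noteq> {}" using A \<open>D \<in> mdeg ` A\<close> by (auto simp: T_def)
  have "Max (nrm ` T) \<in> nrm ` T" using T by (intro Max_in) auto
  then obtain \<tau> where "\<tau> \<in> T" "nrm \<tau> = Max (nrm ` T)" by force
  then have \<tau>: "\<tau> \<in> T" "\<And>\<beta>. \<beta> \<in> T \<Longrightarrow> nrm \<beta> \<le> nrm \<tau>"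
    using T by simp_all
  have only: "\<beta> = \<tau> \<and> \<gamma> = \<tau>" if "\<beta> \<in> A" "\<gamma> \<in> A" "\<beta> + \<gamma> = \<tau> + \<tau>" for \<beta> \<gamma>
  proof -
    have "mdeg (\<beta> + \<gamma>) = mdeg (\<tau> + \<tau>)" using that(3) by simp
    then have "mdeg \<beta> + mdeg \<gamma> = D + D" using \<tau>(1) by (simp add: T_def)
    then have "\<beta> \<in> T" "\<gamma> \<in> T" using D[OF that(1)] D[OF that(2)] that by (auto simp: T_def)
    then have "\<beta> = \<tau>"
      using max_norm_midpoint[OF that(3)] \<tau>(2) by (simp add: nrm_def)
    then show ?thesis using that(3) by simp
  qed
  have sq: "lookup (p k * p k) (\<tau> + \<tau>) = (lookup (p k) \<tau>)\<^sup>2" if "k \<in> I" for k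
  proof -
    have sub: "keys (p k) \<subseteq> A" using that by (auto simp: A_def)
    have "lookup (p k * p k) (\<tau> + \<tau>) = (\<Sum>\<beta>\<in>keys (p k). \<Sum>\<gamma>\<in>keys (p k).
        if \<beta> + \<gamma> = \<tau> + \<tau> then lookup (p k) \<beta> * lookup (p k) \<gamma> else 0)"
      by (simp add: mult_eq_sum_monomials lookup_sum lookup_single when_def)
    also have "\<dots> = (\<Sum>\<beta>\<in>keys (p k). \<Sum>\<gamma>\<in>keys (p k).
        if \<gamma> = \<tau> then (if \<beta> = \<tau> then lookup (p k) \<beta> * lookup (p k) \<gamma> else 0) else 0)"
    proof (intro sum.cong refl)
      fix \<beta> \<gamma> assume "\<beta> \<in> keys (p k)" "\<gamma> \<in> keys (p k)"
      then show "(if \<beta> + \<gamma> = \<tau> + \<tau> then lookup (p k) \<beta> * lookup (p k) \<gamma> else 0) =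
          (if \<gamma> = \<tau> then (if \<beta> = \<tau> then lookup (p k) \<beta> * lookup (p k) \<gamma> else 0) else 0)"
        using only[of \<beta> \<gamma>] sub by auto
    qed
    also have "\<dots> = (lookup (p k) \<tau>)\<^sup>2"
      by (cases "lookup (p k) \<tau> = 0") (auto simp: sum.delta in_keys_iff power2_eq_square)
    finally show ?thesis .
  qed
  have "\<tau> \<in> A" using \<tau>(1) by (simp add: T_def)
  then obtain l where l: "l \<in> I" "lookup (p l) \<tau> \<noteq> 0" by (auto simp: A_def in_keys_iff)
  have "0 < (\<Sum>k\<in>I. (lookup (p k) \<tau>)\<^sup>2)"
    using l assms(1) by (intro sum_pos2[of _ l]) auto
  then have "\<tau> + \<tau> \<in> keys (\<Sum>k\<in>I. p k * p k)"
    by (simp add: in_keys_iff lookup_sum sq)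
  moreover have "2 * mdeg \<alpha> \<le> mdeg (\<tau> + \<tau>)"
    using D[OF A(2)] \<tau>(1) by (simp add: T_def)
  ultimately show ?thesis by (rule that)
qed

section \<open>Jensen's inequality for SOS-convex polynomials\<close>

text \<open>The polynomials \<open>segment_subst y s i\<close> are the coordinates of \<open>y + s (x - y)\<close>, so substituting
  them restricts a polynomial to the segment from \<open>y\<close> to the point of indeterminates
  \<open>x\<close>.\<close>

abbreviation centered :: "real ^ 'l \<Rightarrow> 'l \<Rightarrow> 'l mpoly" where
  "centered y i \<equiv> pvar i - pconst (y $ i)"

definition segment_subst :: "real ^ 'l \<Rightarrow> real \<Rightarrow> 'l \<Rightarrow> 'l mpoly" where
  "segment_subst y s i = pconst (y $ i) + pconst s * centered y i"

lemma truncated_centered: "centered y i \<in> truncated 1"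
proof -
  have "pvar i + - pconst (y $ i) \<in> truncated 1"
    unfolding pvar_def by (intro truncated_add truncated_uminus truncated_single) auto
  then show ?thesis by simp
qed

lemma truncated_segment_subst: "segment_subst y s i \<in> truncated 1"
proof -
  have "pconst s * centered y i \<in> truncated (0 + 1)"
    by (intro truncated_mult truncated_single truncated_centered) simp
  then show ?thesis
    unfolding segment_subst_def by (intro truncated_add truncated_single) auto
qed

lemma segment_subst_0: "psubst (segment_subst y 0) q = pconst (peval q y)"
  using psubst_point[of y q] by (simp add: segment_subst_def[abs_def])

lemma segment_subst_1: "psubst (segment_subst y 1) q = q"
  using psubst_var[of q] by (simp add: segment_subst_def[abs_def])

text \<open>This is the chain rule along the segment, observed through the linear functional given by
  \<open>w\<close>, so that only real-valued functions are differentiated. The factor \<open>p\<close> serves two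
  purposes: in the induction it absorbs the variable split off from \<open>q\<close>, and it allows the
  rule to be applied a second time to the first derivative.\<close>

lemma pairing_segment_deriv:
  fixes p q :: "'l::finite mpoly"
  shows "((\<lambda>s. pairing (p * psubst (segment_subst y s) q) w) has_real_derivative
    pairing (p * (\<Sum>i\<in>UNIV. psubst (segment_subst y s) (partial_deriv i q) * centered y i)) w) (at s)"
proof (induction q arbitrary: p rule: mpoly_induct)
  case (const r)
  show ?case by simp
next
  case (add q1 q2)
  show ?case
    using DERIV_add[OF add.IH(1)[of p] add.IH(2)[of p]]
    by (simp add: psubst_add partial_deriv_add distrib_left distrib_right sum.distrib pairing_add)
next
  case (var j q)
  define G where "G s = (\<Sum>i\<in>UNIV. psubst (segment_subst y s) (partial_deriv i q) * centered y i)" for s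
  let ?c = "pconst (y $ j)" and ?v = "centered y j"
  \<comment> \<open>The new factor \<open>y\<^sub>j + s (x\<^sub>j - y\<^sub>j)\<close> is affine in \<open>s\<close>; its two coefficients move into \<open>p\<close>.\<close>
  have fn: "pairing (p * psubst (segment_subst y s) (pvar j * q)) w =
      pairing ((p * ?c) * psubst (segment_subst y s) q) w +
      s * pairing ((p * ?v) * psubst (segment_subst y s) q) w" for s
    unfolding psubst_var_mult segment_subst_def[of y s j] pairing_const_mult[symmetric]
      pairing_add[symmetric]
    by (simp only: distrib_left distrib_right mult_ac)
  have "(\<Sum>i\<in>UNIV. psubst (segment_subst y s) (partial_deriv i (pvar j * q)) * centered y i) =
      (\<Sum>i\<in>UNIV. (if i = j then psubst (segment_subst y s) q * centered y i else 0) +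
        segment_subst y s j * (psubst (segment_subst y s) (partial_deriv i q) * centered y i))"
    by (intro sum.cong refl)
      (simp add: partial_deriv_var_mult psubst_add psubst_var_mult distrib_right mult.assoc)
  also have "\<dots> = psubst (segment_subst y s) q * ?v + segment_subst y s j * G s"
    by (simp add: sum.distrib sum.delta G_def sum_distrib_left del: mult_minus_right)
  finally have dv: "pairing (p * (\<Sum>i\<in>UNIV. psubst (segment_subst y s)
        (partial_deriv i (pvar j * q)) * centered y i)) w =
      pairing ((p * ?c) * G s) w +
      (1 * pairing ((p * ?v) * psubst (segment_subst y s) q) w + pairing ((p * ?v) * G s) w * s)"
    unfolding mult.commute[of _ s] pairing_const_mult[symmetric] segment_subst_def[of y s j]
    by (simp only: pairing_add[symmetric] distrib_left distrib_right mult_ac mult_1_left single_one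
        add_ac)
  show ?case
    unfolding fn dv G_def
    by (intro DERIV_add DERIV_mult DERIV_ident var.IH)
qed

text \<open>The hypotheses say that pairing with \<open>w\<close> is a normalised functional which is
  nonnegative on squares of degree at most \<open>2 * t\<close>. It plays the role of an expectation, and
  \<open>first_moments w\<close> that of the mean.\<close>

theorem sos_convex_jensen:
  fixes \<psi> :: "'l::finite mpoly"
  assumes "sos_convex \<psi>" and deg: "\<psi> \<in> truncated (2 * t)"
    and psd: "psd_on (mindices t) (\<lambda>\<alpha> \<beta>. lookup w (\<alpha> + \<beta>))"
    and w0: "lookup w 0 = 1"
  shows "peval \<psi> (first_moments w) \<le> pairing \<psi> w"
proof -
  define y where "y = first_moments w"
  obtain r L where L: "\<And>i j. partial_deriv i (partial_deriv j \<psi>) = (\<Sum>k<r::nat. L i k * L j k)"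
    using assms(1) unfolding sos_convex_def by blast
  define \<sigma> where "\<sigma> s = psubst (segment_subst y s)" for s
  define \<phi> where "\<phi> s = pairing (\<sigma> s \<psi>) w" for s
  define \<phi>' where "\<phi>' s = (\<Sum>i\<in>UNIV. pairing (centered y i * \<sigma> s (partial_deriv i \<psi>)) w)" for s
  define \<phi>'' where "\<phi>'' s = (\<Sum>i\<in>UNIV. pairing (centered y i *
    (\<Sum>j\<in>UNIV. \<sigma> s (partial_deriv j (partial_deriv i \<psi>)) * centered y j)) w)" for s
  have d1: "(\<phi> has_real_derivative \<phi>' s) (at s)" for s
    using pairing_segment_deriv[of 1 y \<psi> w s]
    by (simp add: \<phi>_def[abs_def] \<phi>'_def \<sigma>_def pairing_sum mult.commute)
  have d2: "(\<phi>' has_real_derivative \<phi>'' s) (at s)" for s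
    unfolding \<phi>'_def[abs_def] \<phi>''_def \<sigma>_def
    by (intro DERIV_sum pairing_segment_deriv)
  \<comment> \<open>The second derivatives of \<open>\<psi>\<close> have degree at most \<open>2 * t - 2\<close>, so \<open>L i k\<close> has degree at
    most \<open>t - 1\<close>. For \<open>t = 0\<close> this argument shows that \<open>L i k\<close> is zero.\<close>
  have Ltrunc: "\<sigma> s (L i k) * centered y i \<in> truncated t" if "k < r" for s i k
  proof (cases "L i k = 0")
    case True
    then show ?thesis by (simp add: \<sigma>_def)
  next
    case False
    have bound: "mdeg \<alpha> + 1 \<le> t" if \<alpha>: "\<alpha> \<in> keys (L i k)" for \<alpha>
    proof -
      obtain \<beta> where \<beta>: "\<beta> \<in> keys (\<Sum>k<r. L i k * L i k)" "2 * mdeg \<alpha> \<le> mdeg \<beta>"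
        using sum_squares_mdeg[of "{..<r}" k \<alpha> "L i"] \<alpha> \<open>k < r\<close> by auto
      let ?e = "Poly_Mapping.single i (1::nat)"
      have "\<beta> + ?e + ?e \<in> keys \<psi>"
        using \<beta>(1) by (auto simp: L[symmetric] in_keys_iff lookup_partial_deriv)
      then have "mdeg (\<beta> + ?e + ?e) \<le> 2 * t"
        using deg unfolding truncated_def mindices_def by blast
      then show ?thesis using \<beta>(2) by simp
    qed
    obtain \<alpha> where "\<alpha> \<in> keys (L i k)" using False by (meson Poly_Mapping.keys_eq_empty ex_in_conv)
    then have t: "t = (t - 1) + 1" using bound by fastforce
    have "L i k \<in> truncated (t - 1)"
      using bound by (fastforce simp: truncated_def mindices_def)
    then have "\<sigma> s (L i k) \<in> truncated (t - 1)"
      unfolding \<sigma>_def by (intro psubst_truncated truncated_segment_subst)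
    then show ?thesis using truncated_mult[OF _ truncated_centered] t by metis
  qed
  have pos: "0 \<le> \<phi>'' s" for s
  proof -
    define Q where "Q k = (\<Sum>i\<in>UNIV. \<sigma> s (L i k) * centered y i)" for k
    have "\<phi>'' s = pairing (\<Sum>i\<in>UNIV. \<Sum>j\<in>UNIV. \<Sum>k<r.
        (\<sigma> s (L i k) * centered y i) * (\<sigma> s (L j k) * centered y j)) w"
      unfolding \<phi>''_def pairing_sum[symmetric] L \<sigma>_def psubst_sum psubst_mult
        sum_distrib_left sum_distrib_right
      by (intro arg_cong[where f = "\<lambda>q. pairing q w"] sum.cong refl) (simp only: mult_ac)
    also have "(\<Sum>i\<in>UNIV. \<Sum>j\<in>UNIV. \<Sum>k<r.
        (\<sigma> s (L i k) * centered y i) * (\<sigma> s (L j k) * centered y j)) = (\<Sum>k<r. Q k * Q k)"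
      unfolding Q_def sum_product
      by (subst sum.swap, subst (2) sum.swap, subst sum.swap)
        (rule sum.cong[OF refl], rule sum.swap)
    finally have "\<phi>'' s = (\<Sum>k<r. pairing (Q k * Q k) w)" by (simp add: pairing_sum)
    moreover have "Q k \<in> truncated t" if "k < r" for k
      unfolding Q_def using that by (intro truncated_sum Ltrunc)
    ultimately show ?thesis
      using psd by (auto intro!: sum_nonneg pairing_square_nonneg)
  qed
  \<comment> \<open>The convex function \<open>\<phi>\<close> lies above its tangent at \<open>0\<close>.\<close>
  have "\<phi>' 0 * (1 - 0) \<le> \<phi> 1 - \<phi> 0"
    using f''_imp_f'[OF convex_UNIV d1 d2 pos, of 0 1] by simp
  moreover have "\<phi>' 0 = 0"
  proof -
    have "pairing (centered y i) w = 0" for i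
      using pairing_add[of "pvar i" "- pconst (y $ i)" w]
      by (simp add: pairing_uminus pairing_single pvar_def w0 y_def first_moments_def)
    then show ?thesis
      by (simp add: \<phi>'_def \<sigma>_def segment_subst_0 mult.commute[of "centered y _"]
          pairing_const_mult)
  qed
  ultimately show ?thesis
    by (simp add: \<phi>_def \<sigma>_def segment_subst_0 segment_subst_1 pairing_single w0 y_def)
qed

section \<open>The lifted constraint and the lift of a point\<close>

lemma lookup_scaleR_mpoly: "lookup (r *\<^sub>R (q :: 'a \<Rightarrow>\<^sub>0 real)) \<alpha> = r * lookup q \<alpha>"
proof -
  have "finite {i. r *\<^sub>R lookup q i \<noteq> 0}"
    by (rule finite_subset[OF _ finite_keys[of q]]) (auto simp: in_keys_iff)
  then show ?thesis by (simp add: scaleR_poly_mapping_def)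
qed

lemma lookup_moment_vec:
  "lookup (moment_vec d \<mu>) \<beta> = (if \<beta> \<in> mindices d then \<integral>\<xi>. monom_at \<beta> \<xi> \<partial>\<mu> else 0)"
  by (simp add: moment_vec_def lookup_sum lookup_single when_def sum.delta)

lemma lookup_lifted_poly:
  "lookup (lifted_poly h d t w) \<beta> =
    (if \<beta> \<in> mindices d then \<Sum>\<alpha>\<in>mindices (2 * t). coeff_matrix h \<beta> \<alpha> * lookup w \<alpha> else 0)"
  by (simp add: lifted_poly_def lookup_sum lookup_single when_def sum.delta)

lemma lifted_poly_truncated: "lifted_poly h d t w \<in> truncated d"
proof -
  have "keys (lifted_poly h d t w) \<subseteq> mindices d"
    by (auto simp: in_keys_iff lookup_lifted_poly split: if_splits)
  then show ?thesis by (simp add: truncated_def)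
qed

lemma truncated_expected_poly:
  fixes h :: "('n::finite, 'p::finite) mpoly2"
  assumes "deg_decision h \<le> e"
  shows "expected_poly h \<mu> \<in> truncated e"
  unfolding expected_poly_def
proof (rule truncated_sum)
  fix \<beta>
  have "lookup h \<beta> \<in> truncated e" using assms by (rule coeff_in_truncated)
  then show "(\<integral>\<xi>. monom_at \<beta> \<xi> \<partial>\<mu>) *\<^sub>R lookup h \<beta> \<in> truncated e"
    by (auto simp: truncated_def in_keys_iff lookup_scaleR_mpoly)
qed

text \<open>Both sides are the bilinear form of the coefficient matrix of \<open>h\<close> at \<open>w\<close> and
  the moments of \<open>\<mu>\<close>, summed in the two possible orders.\<close>

lemma pairing_lifted_poly:
  fixes h :: "('n::finite, 'p::finite) mpoly2"
  assumes "deg_decision h \<le> 2 * t"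
  shows "pairing (lifted_poly h (deg_random h) t w) (moment_vec (deg_random h) \<mu>) =
    pairing (expected_poly h \<mu>) w"
proof -
  let ?d = "deg_random h"
  define m where "m \<beta> = (\<integral>\<xi>. monom_at \<beta> \<xi> \<partial>\<mu>)" for \<beta> :: "'p mindex"
  have keys_h: "keys h \<subseteq> mindices ?d" by (auto simp: mindices_def mdeg_le_deg_random)
  have row: "(\<Sum>\<alpha>\<in>mindices (2 * t). coeff_matrix h \<beta> \<alpha> * lookup w \<alpha>) = pairing (lookup h \<beta>) w" for \<beta>
    using coeff_in_truncated[OF assms, of \<beta>]
    by (simp add: coeff_matrix_def pairing_superset[of "mindices (2 * t)"] truncated_def)
  have scale: "m \<beta> *\<^sub>R lookup h \<beta> = pconst (m \<beta>) * lookup h \<beta>" for \<beta>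
    by (intro poly_mapping_eqI) (simp add: lookup_scaleR_mpoly lookup_const_mult)
  have "pairing (lifted_poly h ?d t w) (moment_vec ?d \<mu>) =
      (\<Sum>\<beta>\<in>mindices ?d. pairing (lookup h \<beta>) w * m \<beta>)"
    using lifted_poly_truncated[of h ?d t w]
    by (simp add: pairing_superset[of "mindices ?d"] truncated_def lookup_lifted_poly
        lookup_moment_vec row m_def)
  also have "\<dots> = (\<Sum>\<beta>\<in>keys h. pairing (lookup h \<beta>) w * m \<beta>)"
    using keys_h by (intro sum.mono_neutral_right) (auto simp: in_keys_iff)
  also have "\<dots> = pairing (expected_poly h \<mu>) w"
    by (simp add: expected_poly_def pairing_sum m_def[symmetric] scale pairing_const_mult
        mult.commute[of _ "m _"])
  finally show ?thesis .
qed

text \<open>The vector of monomials at a point is the moment vector of the Dirac measure there. Its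
  moment matrix has rank one, which is why it is positive semidefinite.\<close>

definition dirac_moments :: "nat \<Rightarrow> real ^ 'l::finite \<Rightarrow> 'l mvec" where
  "dirac_moments e u = (\<Sum>\<alpha>\<in>mindices e. Poly_Mapping.single \<alpha> (monom_at \<alpha> u))"

lemma lookup_dirac_moments:
  "lookup (dirac_moments e u) \<alpha> = (if mdeg \<alpha> \<le> e then monom_at \<alpha> u else 0)"
proof -
  have "lookup (dirac_moments e u) \<alpha> = (if \<alpha> \<in> mindices e then monom_at \<alpha> u else 0)"
    by (simp add: dirac_moments_def lookup_sum lookup_single when_def sum.delta)
  then show ?thesis by (simp add: mindices_def)
qed

lemma truncated_dirac_moments: "dirac_moments e u \<in> truncated e"
  unfolding dirac_moments_def
  by (intro truncated_sum truncated_single) (simp add: mindices_def)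

lemma pairing_dirac_moments:
  assumes "q \<in> truncated e"
  shows "pairing q (dirac_moments e u) = peval q u"
  using assms
  by (auto simp: pairing_def peval_def truncated_def mindices_def lookup_dirac_moments
      intro!: sum.cong)

lemma monom_at_add: "monom_at (\<alpha> + \<beta>) u = monom_at \<alpha> u * monom_at \<beta> u"
  by (simp add: monom_at_def lookup_add power_add prod.distrib)

lemma monom_at_single: "monom_at (Poly_Mapping.single i 1) u = u $ i"
proof -
  have "(\<Prod>j\<in>UNIV. (u $ j) ^ lookup (Poly_Mapping.single i 1) j) =
      (\<Prod>j\<in>UNIV. if j = i then u $ j else 1)"
    by (intro prod.cong) (auto simp: lookup_single when_def)
  then show ?thesis by (simp add: monom_at_def prod.delta)
qed

lemma psd_dirac_moments:
  assumes "2 * t \<le> e"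
  shows "psd_on (mindices t) (\<lambda>\<alpha> \<beta>. lookup (dirac_moments e u) (\<alpha> + \<beta>))"
  unfolding psd_on_def
proof (intro conjI ballI allI)
  fix v
  have "(\<Sum>\<alpha>\<in>mindices t. \<Sum>\<beta>\<in>mindices t. v \<alpha> * lookup (dirac_moments e u) (\<alpha> + \<beta>) * v \<beta>) =
      (\<Sum>\<alpha>\<in>mindices t. v \<alpha> * monom_at \<alpha> u)\<^sup>2"
    using assms
    by (auto simp: lookup_dirac_moments mindices_def monom_at_add power2_eq_square sum_product
        mult_ac intro!: sum.cong)
  then show "0 \<le> (\<Sum>\<alpha>\<in>mindices t. \<Sum>\<beta>\<in>mindices t.
      v \<alpha> * lookup (dirac_moments e u) (\<alpha> + \<beta>) * v \<beta>)" by simp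
qed (simp add: add.commute)

text \<open>The \<open>y\<close> with \<open>0 \<le> pairing q y\<close> form a convex cone, so the inequality spreads from
  the generators to their hull.\<close>

lemma dual_cone_convex_cone_hull: "dual_cone d (convex_cone hull T) = dual_cone d T"
proof
  show "dual_cone d (convex_cone hull T) \<subseteq> dual_cone d T"
    by (auto simp: dual_cone_def hull_inc)
  show "dual_cone d T \<subseteq> dual_cone d (convex_cone hull T)"
  proof
    fix q assume q: "q \<in> dual_cone d T"
    have "pairing q (y + z) = pairing q y + pairing q z" for y z
      by (simp add: pairing_def lookup_add distrib_left sum.distrib)
    moreover have "pairing q (r *\<^sub>R y) = r * pairing q y" for r y
      by (simp add: pairing_def lookup_scaleR_mpoly sum_distrib_left mult_ac)
    ultimately have "convex_cone {y. 0 \<le> pairing q y}"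
      by (auto simp: convex_cone_iff pairing_def)
    moreover have "T \<subseteq> {y. 0 \<le> pairing q y}" using q by (auto simp: dual_cone_def)
    ultimately have "convex_cone hull T \<subseteq> {y. 0 \<le> pairing q y}" by (rule hull_minimal[rotated])
    then show "q \<in> dual_cone d (convex_cone hull T)" using q by (auto simp: dual_cone_def)
  qed
qed

lemma lifted_poly_in_dual_cone_iff:
  fixes h :: "('n::finite, 'p::finite) mpoly2"
  assumes "deg_decision h \<le> 2 * t"
  shows "lifted_poly h (deg_random h) t w
      \<in> dual_cone (deg_random h) (convex_cone hull (moment_vec (deg_random h) ` M))
    \<longleftrightarrow> (\<forall>\<mu>\<in>M. 0 \<le> pairing (expected_poly h \<mu>) w)"
  unfolding dual_cone_convex_cone_hull
  by (simp add: dual_cone_def lifted_poly_truncated pairing_lifted_poly[OF assms])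

lemma dro_feasible_iff:
  fixes h :: "('n::finite, 'p::finite) mpoly2"
  assumes "M = ambiguity_set (deg_random h) S Y"
  shows "dro_feasible h X M x \<longleftrightarrow> x \<in> X \<and> (\<forall>\<mu>\<in>M. 0 \<le> peval (expected_poly h \<mu>) x)"
  using assms by (simp add: dro_feasible_def le_INF_iff peval_expected_poly zero_ereal_def)

theorem theorem3p2:
  fixes f :: "'n::finite mpoly"
    and c :: "'n mpoly list"
    and h :: "('n, 'p::finite) mpoly2"
    and g :: "'p mpoly list"
    and Y :: "'p mvec set"
    and x :: "real ^ 'n"
  defines "d \<equiv> deg_random h"
    and "t \<equiv> relax_order f c h"
    and "X \<equiv> basic_set c"
    and "S \<equiv> basic_set g"
  defines "M \<equiv> ambiguity_set d S Y"
  defines "K \<equiv> convex_cone hull (moment_vec d ` M)"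
  assumes "conic_set d Y"
    and "dual_cone d K = nonneg_polys d S + dual_cone d Y"
    and "\<And>\<mu>. \<mu> \<in> M \<Longrightarrow> sos_concave (expected_poly h \<mu>)"
  shows "is_arg_min (peval f) (dro_feasible h X M) x \<longleftrightarrow>
    (\<exists>w. is_arg_min (\<lambda>(x, w). peval f x)
       (relax_feasible h d t X (nonneg_polys d S + dual_cone d Y)) (x, w))"
proof -
  define Q where "Q = nonneg_polys d S + dual_cone d Y"
  have t: "deg_decision h \<le> 2 * t" unfolding t_def by (rule deg_decision_le_relax_order)
  have inQ: "lifted_poly h d t w \<in> Q \<longleftrightarrow> (\<forall>\<mu>\<in>M. 0 \<le> pairing (expected_poly h \<mu>) w)" for w
    using lifted_poly_in_dual_cone_iff[OF t, of w M] assms(8) by (simp add: Q_def K_def d_def)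
  have dro: "dro_feasible h X M x \<longleftrightarrow> x \<in> X \<and> (\<forall>\<mu>\<in>M. 0 \<le> peval (expected_poly h \<mu>) x)" for x
    by (rule dro_feasible_iff) (simp add: M_def d_def)
  \<comment> \<open>The order is \<open>max (2 * t) 1\<close> so that for \<open>t = 0\<close> the first moments of the lift still
    recover \<open>x\<close>.\<close>
  have lift: "\<exists>w. relax_feasible h d t X Q (x, w)" if "dro_feasible h X M x" for x
  proof
    let ?e = "max (2 * t) 1"
    have "expected_poly h \<mu> \<in> truncated ?e" for \<mu>
      using t by (intro truncated_expected_poly) simp
    then have "lifted_poly h d t (dirac_moments ?e x) \<in> Q"
      using that by (simp add: inQ dro pairing_dirac_moments)
    moreover have "first_moments (dirac_moments ?e x) = x"
      unfolding first_moments_def lookup_dirac_moments monom_at_single mdeg_single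
      by (simp add: vec_eq_iff)
    moreover have "lookup (dirac_moments ?e x) 0 = 1"
      by (simp add: lookup_dirac_moments monom_at_def)
    ultimately show "relax_feasible h d t X Q (x, dirac_moments ?e x)"
      using that by (simp add: relax_feasible_def dro truncated_dirac_moments psd_dirac_moments)
  qed
  have proj: "dro_feasible h X M x" if "relax_feasible h d t X Q (x, w)" for x w
  proof -
    have w: "lifted_poly h d t w \<in> Q" "x = first_moments w" "x \<in> X"
      "psd_on (mindices t) (\<lambda>\<alpha> \<beta>. lookup w (\<alpha> + \<beta>))" "lookup w 0 = 1"
      using that by (auto simp: relax_feasible_def)
    have "0 \<le> peval (expected_poly h \<mu>) x" if "\<mu> \<in> M" for \<mu>
    proof -
      let ?q = "expected_poly h \<mu>"
      have "peval (- ?q) x \<le> pairing (- ?q) w"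
        unfolding w(2) using assms(9)[OF that] w(4,5) truncated_expected_poly[OF t, of \<mu>]
        by (intro sos_convex_jensen) (auto simp: sos_concave_def truncated_uminus)
      moreover have "peval (- ?q) x = - peval ?q x"
        by (simp add: peval_def sum_negf)
      moreover have "0 \<le> pairing ?q w" using w(1) that by (simp add: inQ)
      ultimately show ?thesis by (simp add: pairing_uminus)
    qed
    then show ?thesis using w(3) by (simp add: dro)
  qed
  show ?thesis
    unfolding is_arg_min_def Q_def[symmetric] using lift proj by fastforce
qed

end
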